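(* There exists a smooth ($C^\infty$) embedding of the torus, $f\colon \mathbf{S}^1\times\mathbf{S}^1\to\mathbf{R}^3$, such that for all $u\in\mathbf{S}^2$ the set $S_u:=\{p\in \mathbf{S}^1\times\mathbf{S}^1 : \langle n(p),u\rangle>0\}$ is connected, where $n\colon\mathbf{S}^1\times\mathbf{S}^1\to\mathbf{S}^2$ is the Gauss map induced by $f$.
   Context: $\mathbf{S}^2$ is the unit sphere in $\mathbf{R}^3$ and $\langle\cdot,\cdot\rangle$ is the standard inner product. The Gauss map induced by $f$ is a smooth unit normal vector field along $f$, i.e. a smooth map $n$ into $\mathbf{S}^2$ with $n(p)$ orthogonal to the image of the differential of $f$ at $p$, for all $p$. $S_u$ is called the shadow in the direction $u$. *)

theory Defs
  imports "HOL-Analysis.Analysis"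
begin

fun C_k :: "nat \<Rightarrow> ('a::euclidean_space \<Rightarrow> 'b::real_normed_vector) \<Rightarrow> bool" where
  "C_k 0 F \<longleftrightarrow> continuous_on UNIV F"
| "C_k (Suc k) F \<longleftrightarrow>
     (\<forall>x. F differentiable (at x)) \<and> (\<forall>v. C_k k (\<lambda>x. frechet_derivative F (at x) v))"

definition C_infinity :: "('a::euclidean_space \<Rightarrow> 'b::real_normed_vector) \<Rightarrow> bool" where
  "C_infinity F \<longleftrightarrow> (\<forall>k. C_k k F)"

definition torus :: "(complex \<times> complex) set" where
  "torus = sphere 0 1 \<times> sphere 0 1"

text \<open>
  The local inverses of \<open>angles\<close> are the usual charts of the torus by pairs of angles, and
  they cover it. So a map \<open>f\<close> on the torus is smooth iff \<open>f \<circ> angles\<close> is smooth on the plane,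
  and the Frechet derivative of \<open>f \<circ> angles\<close> at \<open>x\<close> is the differential of \<open>f\<close> at \<open>angles x\<close>,
  written in such a chart. Values of \<open>f\<close> off the torus play no role.
\<close>

definition angles :: "real \<times> real \<Rightarrow> complex \<times> complex" where
  "angles x = (cis (fst x), cis (snd x))"

definition torus_smooth :: "(complex \<times> complex \<Rightarrow> 'b::real_normed_vector) \<Rightarrow> bool" where
  "torus_smooth f \<longleftrightarrow> C_infinity (f \<circ> angles)"

definition torus_differential ::
    "(complex \<times> complex \<Rightarrow> 'b::real_normed_vector) \<Rightarrow> real \<times> real \<Rightarrow> real \<times> real \<Rightarrow> 'b" where
  "torus_differential f x = frechet_derivative (f \<circ> angles) (at x)"

definition smooth_torus_embedding :: "(complex \<times> complex \<Rightarrow> real ^ 3) \<Rightarrow> bool" where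
  "smooth_torus_embedding f \<longleftrightarrow>
     torus_smooth f \<and>
     (\<forall>x. inj (torus_differential f x)) \<and>
     embedding_map (top_of_set torus) euclidean f"

text \<open>
  On the connected torus the Gauss map is determined up to a global sign. Changing the sign
  turns the shadow in direction \<open>u\<close> into the one in direction \<open>- u\<close>, so a condition on the
  shadows in all directions does not depend on the choice.
\<close>

definition gauss_map ::
    "(complex \<times> complex \<Rightarrow> real ^ 3) \<Rightarrow> (complex \<times> complex \<Rightarrow> real ^ 3) \<Rightarrow> bool" where
  "gauss_map f n \<longleftrightarrow>
     torus_smooth n \<and>
     (\<forall>p\<in>torus. n p \<in> sphere 0 1) \<and>
     (\<forall>x v. n (angles x) \<bullet> torus_differential f x v = 0)"

definition shadow :: "(complex \<times> complex \<Rightarrow> real ^ 3) \<Rightarrow> real ^ 3 \<Rightarrow> (complex \<times> complex) set" where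
  "shadow n u = {p \<in> torus. n p \<bullet> u > 0}"

end

theory Submission
  imports Defs
begin

text \<open>
  The surface is a thin round tube about a closed curve without parallel tangent lines at
  different points (a skew loop). Along the normal circle over a point of the curve, the shadow
  in direction \<open>u\<close> is an open half circle, unless the tangent there is parallel to \<open>u\<close>, when it
  is empty. As the latter happens at most once, the shadow is a bundle of half circles over a
  circle with at most one point removed, hence connected.

  The skew loop has velocity \<open>r (cos t, sin t, h)\<close> with \<open>r = 1 - cos (3 t) / 2\<close> and
  \<open>h = 1 + 4 cos (3 t)\<close>. Each component has mean zero, so the curve closes up. The first two
  coordinates show that tangents at different points can be parallel only for opposite
  parameters \<open>t\<close> and \<open>t + pi\<close>, where \<open>h\<close> would have to change sign; but the sum of its values
  there is 2. Since \<open>r > 0\<close>, the horizontal projection is a convex curve, so the loop is simple.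
\<close>

subsection \<open>Smooth maps\<close>

text \<open>\<open>C_k (Suc k)\<close> speaks only of derivatives, so continuity of \<open>F\<close>
  has to come from differentiability. The product rule needs this, as it leaves one factor
  undifferentiated.\<close>

lemma C_k_antimono: "C_k (Suc k) F \<Longrightarrow> C_k k F"
proof (induction k arbitrary: F)
  case 0
  then show ?case
    by (auto simp: continuous_on_eq_continuous_at differentiable_imp_continuous_within)
next
  case (Suc k)
  then show ?case
    using C_k.simps(2) by blast
qed

lemma C_k_differentiable: "C_k (Suc k) F \<Longrightarrow> (F has_derivative frechet_derivative F (at x)) (at x)"
  by (simp add: frechet_derivative_works)

lemma C_k_SucI:
  assumes "\<And>x. (F has_derivative F' x) (at x)" "\<And>v. C_k k (\<lambda>x. F' x v)"
  shows "C_k (Suc k) F"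
proof -
  have "frechet_derivative F (at x) = F' x" for x
    using frechet_derivative_at[OF assms(1)] by simp
  with assms show ?thesis
    by (auto simp: differentiable_def)
qed

lemma C_k_const: "C_k k (\<lambda>x. c)"
proof (induction k arbitrary: c)
  case (Suc k)
  show ?case
    by (rule C_k_SucI[where F' = "\<lambda>x v. 0"]) (auto intro: Suc)
qed simp

lemma C_k_add: "C_k k F \<Longrightarrow> C_k k G \<Longrightarrow> C_k k (\<lambda>x. F x + G x)"
proof (induction k arbitrary: F G)
  case 0
  then show ?case by (simp add: continuous_on_add)
next
  case (Suc k)
  show ?case
  proof (rule C_k_SucI)
    show "((\<lambda>x. F x + G x) has_derivative
        (\<lambda>v. frechet_derivative F (at x) v + frechet_derivative G (at x) v)) (at x)" for x
      by (intro has_derivative_add C_k_differentiable[OF Suc.prems(1)] C_k_differentiable[OF Suc.prems(2)])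
    show "C_k k (\<lambda>x. frechet_derivative F (at x) v + frechet_derivative G (at x) v)" for v
      using Suc by auto
  qed
qed

lemma C_k_bilinear:
  assumes "bounded_bilinear h"
  shows "C_k k F \<Longrightarrow> C_k k G \<Longrightarrow> C_k k (\<lambda>x. h (F x) (G x))"
proof (induction k arbitrary: F G)
  case 0
  then show ?case by (simp add: bounded_bilinear.continuous_on[OF assms])
next
  case (Suc k)
  show ?case
  proof (rule C_k_SucI)
    show "((\<lambda>x. h (F x) (G x)) has_derivative
        (\<lambda>v. h (F x) (frechet_derivative G (at x) v) + h (frechet_derivative F (at x) v) (G x))) (at x)" for x
      by (intro bounded_bilinear.FDERIV[OF assms] C_k_differentiable[OF Suc.prems(1)]
          C_k_differentiable[OF Suc.prems(2)])
    show "C_k k (\<lambda>x. h (F x) (frechet_derivative G (at x) v) + h (frechet_derivative F (at x) v) (G x))" for v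
      using Suc.prems C_k_antimono[OF Suc.prems(1)] C_k_antimono[OF Suc.prems(2)]
      by (intro C_k_add Suc.IH) auto
  qed
qed

text \<open>The exponent varies in the induction, as the derivative contains the power with exponent
  \<open>a - 1\<close>. This serves the normalising factor in \<open>binormal\<close>.\<close>

lemma C_k_powr:
  fixes F :: "'a::euclidean_space \<Rightarrow> real"
  assumes "\<And>x. F x > 0"
  shows "C_k k F \<Longrightarrow> C_k k (\<lambda>x. F x powr a)"
proof (induction k arbitrary: a)
  case 0
  then show ?case using assms
    by (auto intro!: continuous_on_powr continuous_on_const simp: less_imp_neq[THEN not_sym])
next
  case (Suc k)
  show ?case
  proof (rule C_k_SucI)
    show "((\<lambda>x. F x powr a) has_derivative
        (\<lambda>v. (a * F x powr (a - 1)) * frechet_derivative F (at x) v)) (at x)" for x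
      using has_derivative_compose[OF C_k_differentiable[OF Suc.prems]
          has_real_derivative_powr[OF assms, unfolded has_field_derivative_def]] .
    show "C_k k (\<lambda>x. (a * F x powr (a - 1)) * frechet_derivative F (at x) v)" for v
      using Suc.prems C_k_antimono[OF Suc.prems]
      by (intro C_k_bilinear[OF bounded_bilinear_mult] C_k_const Suc.IH) auto
  qed
qed

text \<open>Proved jointly, since each function occurs in the derivative of the other.\<close>

lemma C_k_cos_sin:
  fixes l :: "'a::euclidean_space \<Rightarrow> real"
  assumes "bounded_linear l"
  shows "C_k k (\<lambda>x. cos (l x)) \<and> C_k k (\<lambda>x. sin (l x))"
proof (induction k)
  case 0
  show ?case
    using linear_continuous_on[OF assms] by (auto intro!: continuous_intros)
next
  case (Suc k)
  have l: "(l has_derivative l) (at x)" for x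
    using assms by (rule bounded_linear_imp_has_derivative)
  have "C_k (Suc k) (\<lambda>x. cos (l x))"
  proof (rule C_k_SucI)
    show "((\<lambda>x. cos (l x)) has_derivative (\<lambda>v. (- l v) * sin (l x))) (at x)" for x
      by (rule has_derivative_eq_rhs[OF has_derivative_cos[OF l]]) auto
    show "C_k k (\<lambda>x. (- l v) * sin (l x))" for v
      using Suc by (intro C_k_bilinear[OF bounded_bilinear_mult] C_k_const) auto
  qed
  moreover have "C_k (Suc k) (\<lambda>x. sin (l x))"
  proof (rule C_k_SucI)
    show "((\<lambda>x. sin (l x)) has_derivative (\<lambda>v. l v * cos (l x))) (at x)" for x
      by (rule has_derivative_eq_rhs[OF has_derivative_sin[OF l]]) auto
    show "C_k k (\<lambda>x. l v * cos (l x))" for v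
      using Suc by (intro C_k_bilinear[OF bounded_bilinear_mult] C_k_const) auto
  qed
  ultimately show ?case ..
qed

lemma C_infinity_const: "C_infinity (\<lambda>x. c)"
  by (simp add: C_infinity_def C_k_const)

lemma C_infinity_add: "C_infinity F \<Longrightarrow> C_infinity G \<Longrightarrow> C_infinity (\<lambda>x. F x + G x)"
  by (simp add: C_infinity_def C_k_add)

lemma C_infinity_scaleR: "C_infinity F \<Longrightarrow> C_infinity G \<Longrightarrow> C_infinity (\<lambda>x. F x *\<^sub>R G x)"
  by (simp add: C_infinity_def C_k_bilinear bounded_bilinear_scaleR)

lemma C_infinity_mult:
  fixes F G :: "'a::euclidean_space \<Rightarrow> real"
  shows "C_infinity F \<Longrightarrow> C_infinity G \<Longrightarrow> C_infinity (\<lambda>x. F x * G x)"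
  by (simp add: C_infinity_def C_k_bilinear bounded_bilinear_mult)

lemma C_infinity_minus:
  fixes F :: "'a::euclidean_space \<Rightarrow> real"
  shows "C_infinity F \<Longrightarrow> C_infinity (\<lambda>x. - F x)"
  using C_infinity_mult[OF C_infinity_const[of "-1"]] by simp

lemma C_infinity_diff:
  fixes F G :: "'a::euclidean_space \<Rightarrow> real"
  shows "C_infinity F \<Longrightarrow> C_infinity G \<Longrightarrow> C_infinity (\<lambda>x. F x - G x)"
  using C_infinity_add[OF _ C_infinity_minus] by fastforce

lemma C_infinity_powr:
  fixes F :: "'a::euclidean_space \<Rightarrow> real"
  shows "(\<And>x. F x > 0) \<Longrightarrow> C_infinity F \<Longrightarrow> C_infinity (\<lambda>x. F x powr a)"
  by (simp add: C_infinity_def C_k_powr)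

lemma C_infinity_power:
  fixes F :: "'a::euclidean_space \<Rightarrow> real"
  shows "C_infinity F \<Longrightarrow> C_infinity (\<lambda>x. F x ^ m)"
  by (induction m) (auto intro: C_infinity_const C_infinity_mult)

lemma C_infinity_cos_sin:
  fixes l :: "'a::euclidean_space \<Rightarrow> real"
  assumes "bounded_linear l"
  shows C_infinity_cos: "C_infinity (\<lambda>x. cos (l x))"
    and C_infinity_sin: "C_infinity (\<lambda>x. sin (l x))"
  using assms by (auto simp: C_infinity_def C_k_cos_sin)

text \<open>Turns a coordinate vector into a sum of scaled constant vectors, to which the rules for
  sums and \<open>*\<^sub>R\<close> apply.\<close>

lemma vector_3_decompose:
  "(vector [a, b, c] :: real ^ 3) = a *\<^sub>R vector [1, 0, 0] + b *\<^sub>R vector [0, 1, 0] + c *\<^sub>R vector [0, 0, 1]"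
  by (simp add: vec_eq_iff forall_3)

lemma inner_vector_3: "vector [a, b, c] \<bullet> (vector [d, e, f] :: real ^ 3) = a * d + b * e + c * f"
  by (simp add: inner_vec_def sum_3)

lemma C_infinity_vector_3:
  fixes F G H :: "'a::euclidean_space \<Rightarrow> real"
  assumes "C_infinity F" "C_infinity G" "C_infinity H"
  shows "C_infinity (\<lambda>x. vector [F x, G x, H x] :: real ^ 3)"
  unfolding vector_3_decompose[of "F _"]
  by (intro C_infinity_add C_infinity_scaleR C_infinity_const assms)

lemma has_vector_derivative_vector_3:
  assumes "(f has_real_derivative f') (at t)" "(g has_real_derivative g') (at t)"
    "(h has_real_derivative h') (at t)"
  shows "((\<lambda>t. vector [f t, g t, h t] :: real ^ 3) has_vector_derivative vector [f', g', h']) (at t)"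
  unfolding vector_3_decompose[of "f _"] vector_3_decompose[of f']
  using assms by (auto intro!: derivative_eq_intros)

lemmas C_infinity_intros = C_infinity_const C_infinity_add C_infinity_diff C_infinity_minus
  C_infinity_mult C_infinity_scaleR C_infinity_power C_infinity_powr C_infinity_cos C_infinity_sin
  C_infinity_vector_3

subsection \<open>A skew loop and its normal frame\<close>

text \<open>With \<open>z = cis t\<close>, this is an antiderivative of the velocity above.\<close>

definition core :: "complex \<Rightarrow> real ^ 3" where
  "core z = vector [Im z - Im (z ^ 4) / 16 - Im (z\<^sup>2) / 8,
                    - Re z + Re (z ^ 4) / 16 - Re (z\<^sup>2) / 8,
                    7 * Im (z ^ 3) / 6 - Im (z ^ 6) / 6]"

definition slope :: "complex \<Rightarrow> real" where
  "slope z = 1 + 4 * Re (z ^ 3)"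

text \<open>The velocity of the core without its positive scalar factor, hence not of unit
  length.\<close>

definition tang :: "complex \<Rightarrow> real ^ 3" where
  "tang z = vector [Re z, Im z, slope z]"

definition normal :: "complex \<Rightarrow> real ^ 3" where
  "normal z = vector [Im z, - Re z, 0]"

text \<open>For \<open>z\<close> on the unit circle, the normalised cross product of
  \<open>tang z\<close> and \<open>normal z\<close>.\<close>

definition binormal :: "complex \<Rightarrow> real ^ 3" where
  "binormal z = (1 + (slope z)\<^sup>2) powr (- 1 / 2) *\<^sub>R vector [slope z * Re z, slope z * Im z, - 1]"

definition gauss :: "complex \<times> complex \<Rightarrow> real ^ 3" where
  "gauss p = Re (snd p) *\<^sub>R normal (fst p) + Im (snd p) *\<^sub>R binormal (fst p)"

lemma one_plus_slope_sq_pos: "1 + (slope z)\<^sup>2 > 0"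
  by (simp add: add_pos_nonneg)

lemma Re_cis_power_numeral: "Re (cis t ^ numeral n) = cos (numeral n * t)"
  and Im_cis_power_numeral: "Im (cis t ^ numeral n) = sin (numeral n * t)"
  using cos_n_Re_cis_pow_n[of "numeral n" t] sin_n_Im_cis_pow_n[of "numeral n" t] by simp_all

lemma slope_cis: "slope (cis t) = 1 + 4 * cos (3 * t)"
  by (simp add: slope_def Re_cis_power_numeral)

lemma core_cis_has_vector_derivative:
  "((\<lambda>t. core (cis t)) has_vector_derivative (1 - cos (3 * t) / 2) *\<^sub>R tang (cis t)) (at t)"
proof -
  have [simp]: "core (cis t) = vector [sin t - sin (4 * t) / 16 - sin (2 * t) / 8,
      - cos t + cos (4 * t) / 16 - cos (2 * t) / 8, 7 * sin (3 * t) / 6 - sin (6 * t) / 6]" for t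
    by (simp add: core_def Re_cis_power_numeral Im_cis_power_numeral)
  \<comment> \<open>No constant terms remain: in the third coordinate the \<open>1\<close> cancels
    against the mean of \<open>2 * (cos (3 * t))\<^sup>2\<close>. Hence the antiderivative is
    periodic.\<close>
  have "(1 - cos (3 * t) / 2) *\<^sub>R tang (cis t) =
      vector [cos t - cos (4 * t) / 4 - cos (2 * t) / 4,
        sin t - sin (4 * t) / 4 + sin (2 * t) / 4, 7 * cos (3 * t) / 2 - cos (6 * t)]"
    using cos_times_cos[of "3 * t" t] sin_times_cos[of t "3 * t"] cos_double_cos[of "3 * t"]
    by (simp add: vec_eq_iff forall_3 tang_def slope_cis field_simps power2_eq_square)
  then show ?thesis
    by simp (rule has_vector_derivative_vector_3; (auto intro!: derivative_eq_intros)[1])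
qed

lemma core_cis_inner_has_real_derivative:
  "((\<lambda>t. core (cis t) \<bullet> u) has_real_derivative ((1 - cos (3 * t) / 2) *\<^sub>R tang (cis t)) \<bullet> u) (at t)"
  unfolding has_real_derivative_iff_has_vector_derivative
  by (rule bounded_linear.has_vector_derivative[OF bounded_linear_inner_left core_cis_has_vector_derivative])

lemma tang_cis_has_vector_derivative:
  "((\<lambda>t. tang (cis t)) has_vector_derivative vector [- sin t, cos t, - 12 * sin (3 * t)]) (at t)"
  unfolding tang_def slope_cis cis.simps
  by (rule has_vector_derivative_vector_3; (auto intro!: derivative_eq_intros)[1])

lemma gauss_inner_tang:
  assumes "norm z = 1"
  shows "gauss (z, w) \<bullet> tang z = 0"
proof -
  have "Re z * Re z + Im z * Im z = 1"
    using assms by (simp add: cmod_def power2_eq_square)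
  then have "slope z * Re z * Re z + slope z * Im z * Im z = slope z"
    by (metis distrib_left mult.assoc mult.right_neutral)
  then show ?thesis
    by (simp add: gauss_def tang_def normal_def binormal_def inner_vector_3 inner_add_left)
qed

lemma frame_orthonormal:
  assumes "norm z = 1"
  shows "normal z \<bullet> normal z = 1" "normal z \<bullet> binormal z = 0" "binormal z \<bullet> binormal z = 1"
proof -
  have z: "(Re z)\<^sup>2 + (Im z)\<^sup>2 = 1"
    using assms by (simp add: cmod_def)
  then show "normal z \<bullet> normal z = 1" "normal z \<bullet> binormal z = 0"
    by (simp_all add: normal_def binormal_def inner_vector_3 power2_eq_square)
  have "(slope z * Re z)\<^sup>2 + (slope z * Im z)\<^sup>2 + 1 = 1 + (slope z)\<^sup>2"
    using z by (simp add: power_mult_distrib flip: distrib_left)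
  moreover have "(1 + (slope z)\<^sup>2) powr (- 1 / 2) * (1 + (slope z)\<^sup>2) powr (- 1 / 2)
      = inverse (1 + (slope z)\<^sup>2)"
    using one_plus_slope_sq_pos[of z] by (simp add: powr_minus flip: powr_add inverse_mult_distrib)
  ultimately show "binormal z \<bullet> binormal z = 1"
    using one_plus_slope_sq_pos[of z]
    by (simp add: binormal_def inner_vector_3 power2_eq_square add.commute flip: mult.assoc)
qed

text \<open>Over a fixed \<open>z\<close>, \<open>gauss\<close> is a linear isometry of the complex
  plane onto the normal plane of the core, because the frame is orthonormal.\<close>

lemma gauss_inner_gauss:
  assumes "norm z = 1"
  shows "gauss (z, w) \<bullet> gauss (z, v) = Re w * Re v + Im w * Im v"
  using frame_orthonormal[OF assms]
  by (simp add: gauss_def inner_add_left inner_add_right inner_commute[of "binormal z" "normal z"])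

lemma norm_gauss:
  assumes "norm z = 1" "norm w = 1"
  shows "norm (gauss (z, w)) = 1"
  using gauss_inner_gauss[OF assms(1), of w w] assms(2)
  by (simp add: norm_eq_sqrt_inner inner_complex_def)

section \<open>Chord and tangent estimates for the skew loop\<close>

lemma cos_diff_abs_le: "\<bar>cos x - cos y\<bar> \<le> \<bar>x - y\<bar>" for x y :: real
proof -
  have "\<bar>cos x - cos y\<bar> = 2 * \<bar>sin ((x + y) / 2)\<bar> * \<bar>sin ((y - x) / 2)\<bar>"
    by (simp add: cos_diff_cos abs_mult)
  also have "\<dots> \<le> 2 * 1 * \<bar>(y - x) / 2\<bar>"
    by (intro mult_mono abs_sin_x_le_abs_x) auto
  finally show ?thesis by simp
qed

lemma sin_diff_abs_le: "\<bar>sin x - sin y\<bar> \<le> \<bar>x - y\<bar>" for x y :: real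
  using cos_diff_abs_le[of "pi / 2 - x" "pi / 2 - y"] by (simp add: cos_diff)

lemma cos_ge_parabola: "cos x \<ge> 1 - x\<^sup>2 / 2" for x :: real
proof -
  have "cos x = 1 - 2 * (sin (x / 2))\<^sup>2"
    using cos_double_sin[of "x / 2"] by simp
  moreover have "(sin (x / 2))\<^sup>2 \<le> (x / 2)\<^sup>2"
    using abs_sin_x_le_abs_x[of "x / 2"] by (simp only: abs_le_square_iff)
  ultimately show ?thesis by (simp add: power2_eq_square)
qed

text \<open>
  In the direction of the middle angle, the chord of the horizontal projection is at least as
  long as half the chord of the unit circle, since the speed is at least one half.
\<close>

lemma core_chord_far:
  assumes "s \<le> t" "t - s \<le> pi"
  shows "sin ((t - s) / 2) \<le> norm (core (cis t) - core (cis s))"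
proof -
  define m where "m = (s + t) / 2"
  define e :: "real ^ 3" where "e = vector [cos m, sin m, 0]"
  have e: "norm e = 1"
    by (simp add: e_def norm_eq_sqrt_inner inner_vector_3 flip: power2_eq_square)
  \<comment> \<open>Its derivative is \<open>cos (x - m)\<close> times the excess of the horizontal
    speed over one half. The cosine is nonnegative since \<open>x\<close> is within
    \<open>pi / 2\<close> of the midpoint \<open>m\<close>.\<close>
  define g where "g = (\<lambda>x. core (cis x) \<bullet> e - sin (x - m) / 2)"
  have "(g has_real_derivative (1 - cos (3 * x)) / 2 * cos (x - m)) (at x)" for x
    unfolding g_def
    by (auto intro!: derivative_eq_intros core_cis_inner_has_real_derivative
        simp: e_def tang_def inner_vector_3 cos_diff field_simps)
  moreover have "(1 - cos (3 * x)) / 2 * cos (x - m) \<ge> 0" if "s \<le> x" "x \<le> t" for x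
    using assms that by (intro mult_nonneg_nonneg cos_ge_zero) (auto simp: m_def field_simps)
  ultimately have "g s \<le> g t"
    using assms(1) by (intro DERIV_nonneg_imp_nondecreasing[of s t g]) blast+
  moreover have "sin (t - m) = sin ((t - s) / 2)" "sin (s - m) = - sin ((t - s) / 2)"
    by (auto simp: m_def field_simps simp flip: sin_minus intro!: arg_cong[of _ _ sin])
  ultimately have "sin ((t - s) / 2) \<le> (core (cis t) - core (cis s)) \<bullet> e"
    by (simp add: g_def inner_diff_left)
  also have "\<dots> \<le> norm (core (cis t) - core (cis s)) * norm e"
    by (rule norm_cauchy_schwarz)
  finally show ?thesis by (simp add: e)
qed

text \<open>By the mean value theorem the chord pairs with the sum of the tangents like an
  intermediate velocity. The horizontal parts contribute almost 2. The vertical part can be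
  negative, since the slope changes sign, but only slightly, since the slopes involved are
  close.\<close>

lemma core_chord_near:
  assumes "s < t" "t - s \<le> 1 / 10"
  shows "(t - s) / 2 \<le> (core (cis t) - core (cis s)) \<bullet> (tang (cis t) + tang (cis s))"
proof -
  define T where "T = tang (cis t) + tang (cis s)"
  obtain x where x: "s < x" "x < t"
    and eq: "core (cis t) \<bullet> T - core (cis s) \<bullet> T =
      (t - s) * (((1 - cos (3 * x) / 2) *\<^sub>R tang (cis x)) \<bullet> T)"
    using MVT2[OF assms(1) core_cis_inner_has_real_derivative[of T]] by blast
  define h where "h = slope (cis x)"
  define k where "k = (slope (cis t) + slope (cis s)) / 2"
  \<comment> \<open>The slope is 12-Lipschitz and the parameters differ by at most
    \<open>1 / 10\<close>.\<close>
  have "\<bar>h - k\<bar> \<le> 12 / 10"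
    using cos_diff_abs_le[of "3 * x" "3 * t"] cos_diff_abs_le[of "3 * x" "3 * s"] x assms(2)
    unfolding h_def k_def slope_cis by argo
  then have "(h - k)\<^sup>2 \<le> 36 / 25"
    using abs_le_square_iff[of "h - k" "12 / 10"] by (simp add: power2_eq_square)
  moreover have "- 72 / 100 \<le> (a - b) / 2" if "0 \<le> a" "b \<le> 36 / 25" for a b :: real
    using that by simp
  \<comment> \<open>By polarisation the right-hand side is \<open>h * (2 * k)\<close>.\<close>
  ultimately have "- 72 / 100 \<le> ((h + k)\<^sup>2 - (h - k)\<^sup>2) / 2"
    using zero_le_power2[of "h + k"] by blast
  then have hk: "- 72 / 100 \<le> h * (2 * k)"
    by (simp add: power2_eq_square algebra_simps)
  have cos: "cos (x - y) \<ge> 199 / 200" if "\<bar>x - y\<bar> \<le> 1 / 10" for y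
  proof -
    have "(x - y)\<^sup>2 \<le> (1 / 10)\<^sup>2"
      using that by (simp add: abs_le_square_iff[symmetric])
    then show ?thesis
      using cos_ge_parabola[of "x - y"] by (simp add: power2_eq_square)
  qed
  have "tang (cis x) \<bullet> T = cos (x - t) + cos (x - s) + h * (2 * k)"
    by (simp add: T_def tang_def inner_add_right inner_vector_3 cos_diff h_def k_def algebra_simps)
  also have "\<dots> \<ge> 1"
    using cos[of t] cos[of s] hk x assms(2) by simp
  finally have "(1 / 2) * 1 \<le> (1 - cos (3 * x) / 2) * (tang (cis x) \<bullet> T)"
    using cos_le_one[of "3 * x"] by (intro mult_mono) linarith+
  then have "(t - s) * (1 / 2) \<le> (t - s) * (((1 - cos (3 * x) / 2) *\<^sub>R tang (cis x)) \<bullet> T)"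
    using assms(1) by (intro mult_left_mono) auto
  then show ?thesis
    using eq by (simp add: T_def inner_diff_left)
qed

lemma norm_vector_3_le: "norm (vector [a, b, c] :: real ^ 3) \<le> \<bar>a\<bar> + \<bar>b\<bar> + \<bar>c\<bar>"
  using norm_le_l1_cart[of "vector [a, b, c] :: real ^ 3"] by (simp add: sum_3)

text \<open>The three coordinates have Lipschitz constants 1, 1 and 12.\<close>

lemma tang_lipschitz: "norm (tang (cis t) - tang (cis s)) \<le> 14 * \<bar>t - s\<bar>"
proof -
  have "tang (cis t) - tang (cis s) = vector [cos t - cos s, sin t - sin s, 4 * (cos (3 * t) - cos (3 * s))]"
    by (simp add: tang_def slope_cis vec_eq_iff forall_3)
  then show ?thesis
    using norm_vector_3_le[of "cos t - cos s" "sin t - sin s" "4 * (cos (3 * t) - cos (3 * s))"]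
      cos_diff_abs_le[of t s] sin_diff_abs_le[of t s] cos_diff_abs_le[of "3 * t" "3 * s"]
    by (simp only:) argo
qed

subsection \<open>The tube about the skew loop\<close>

definition tube :: "real \<Rightarrow> complex \<times> complex \<Rightarrow> real ^ 3" where
  "tube \<epsilon> p = core (fst p) + \<epsilon> *\<^sub>R gauss p"

text \<open>
  For far apart parameters the distance of the core points exceeds the diameter of the normal
  circles. For close ones the sum of the two tangents separates the circles: the difference of the
  normals paired with the sum of the tangents is the sum of the normals paired with the difference
  of the tangents, hence small.
\<close>

lemma tube_neq:
  assumes "0 < \<epsilon>" "\<epsilon> \<le> 1 / 100" "2 * \<epsilon> < sin (1 / 20)"
    and "s < t" "t - s \<le> pi" and [simp]: "norm w = 1" "norm v = 1"
  shows "tube \<epsilon> (cis t, w) \<noteq> tube \<epsilon> (cis s, v)"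
proof
  assume "tube \<epsilon> (cis t, w) = tube \<epsilon> (cis s, v)"
  then have eq: "core (cis t) - core (cis s) = \<epsilon> *\<^sub>R (gauss (cis s, v) - gauss (cis t, w))"
    by (simp add: tube_def algebra_simps)
  have n[simp]: "norm (gauss (cis s, v)) = 1" "norm (gauss (cis t, w)) = 1"
    by (simp_all add: norm_gauss)
  show False
  proof (cases "t - s \<le> 1 / 10")
    case True
    have "(t - s) / 2 \<le> \<epsilon> * ((gauss (cis s, v) - gauss (cis t, w)) \<bullet> (tang (cis t) + tang (cis s)))"
      using core_chord_near[OF assms(4) True] by (simp add: eq)
    also have "(gauss (cis s, v) - gauss (cis t, w)) \<bullet> (tang (cis t) + tang (cis s)) =
        (gauss (cis s, v) + gauss (cis t, w)) \<bullet> (tang (cis t) - tang (cis s))"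
      by (simp add: algebra_simps gauss_inner_tang)
    also have "\<epsilon> * \<dots> \<le> \<epsilon> * (2 * (14 * \<bar>t - s\<bar>))"
    proof (intro mult_left_mono order.trans[OF norm_cauchy_schwarz] mult_mono tang_lipschitz)
      show "norm (gauss (cis s, v) + gauss (cis t, w)) \<le> 2"
        using norm_triangle_ineq[of "gauss (cis s, v)" "gauss (cis t, w)"] by simp
    qed (use assms(1) in auto)
    \<comment> \<open>This leaves the factor \<open>28 / 100\<close>, less than the
      \<open>1 / 2\<close> on the left.\<close>
    also have "\<dots> \<le> 1 / 100 * (2 * (14 * \<bar>t - s\<bar>))"
      using assms(2) by (intro mult_right_mono) auto
    finally show False
      using assms(4) by simp
  next
    case False
    \<comment> \<open>Half the parameter gap lies between \<open>1 / 20\<close> and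
      \<open>pi / 2\<close>, where the sine increases.\<close>
    have "sin (1 / 20) \<le> sin ((t - s) / 2)"
      using False assms(5) pi_ge_two by (intro sin_monotone_2pi_le) auto
    also have "\<dots> \<le> norm (core (cis t) - core (cis s))"
      using assms by (intro core_chord_far) auto
    also have "\<dots> = \<epsilon> * norm (gauss (cis s, v) - gauss (cis t, w))"
      using assms(1) by (simp add: eq)
    also have "\<dots> \<le> \<epsilon> * 2"
      using assms(1) norm_triangle_ineq4[of "gauss (cis s, v)" "gauss (cis t, w)"]
      by (intro mult_left_mono) auto
    finally show False
      using assms(3) by simp
  qed
qed

text \<open>One of the two arcs between the points has length at most \<open>pi\<close>. If the
  arguments are further apart, adding \<open>2 * pi\<close> to the smaller one selects the other arc
  and exchanges the roles of the points.\<close>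

lemma unit_circle_pair_cases:
  assumes "norm z = 1" "norm z' = 1" "z \<noteq> z'"
  obtains s t where "s < t" "t - s \<le> pi" "z = cis s \<and> z' = cis t \<or> z = cis t \<and> z' = cis s"
proof -
  have cis_Arg_unit: "cis (Arg z) = z" if "norm z = 1" for z
    using that rcis_cmod_Arg[of z] by (simp add: rcis_def)
  have *: "\<exists>s t. s < t \<and> t - s \<le> pi \<and> (z = cis s \<and> z' = cis t \<or> z = cis t \<and> z' = cis s)"
    if "norm z = 1" "norm z' = 1" "Arg z < Arg z'" for z z'
  proof (cases "Arg z' - Arg z \<le> pi")
    case True
    then show ?thesis
      using that cis_Arg_unit by metis
  next
    case False
    have "cis (Arg z + 2 * pi) = cis (Arg z)"
      by (simp add: complex_eq_iff)
    moreover have "Arg z' < Arg z + 2 * pi" "Arg z + 2 * pi - Arg z' \<le> pi"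
      using False Arg_le_pi[of z'] mpi_less_Arg[of z] by linarith+
    ultimately show ?thesis
      using that cis_Arg_unit by metis
  qed
  have "Arg z \<noteq> Arg z'"
    using assms cis_Arg_unit by metis
  then consider "Arg z < Arg z'" | "Arg z' < Arg z" by linarith
  then show ?thesis
    using *[OF assms(1,2)] *[OF assms(2,1)] that by cases blast+
qed

lemma tube_inj_on:
  assumes "0 < \<epsilon>" "\<epsilon> \<le> 1 / 100" "2 * \<epsilon> < sin (1 / 20)"
  shows "inj_on (tube \<epsilon>) torus"
proof (rule inj_onI)
  fix p q
  assume p: "p \<in> torus" and q: "q \<in> torus" and eq: "tube \<epsilon> p = tube \<epsilon> q"
  obtain z w z' v where pq: "p = (z, w)" "q = (z', v)"
    by (metis surj_pair)
  have [simp]: "norm z = 1" "norm w = 1" "norm z' = 1" "norm v = 1"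
    using p q by (auto simp: pq torus_def)
  have "z = z'"
  proof (rule ccontr)
    assume "z \<noteq> z'"
    then obtain s t where "s < t" "t - s \<le> pi" "z = cis s \<and> z' = cis t \<or> z = cis t \<and> z' = cis s"
      using unit_circle_pair_cases[of z z'] by auto
    then show False
      using tube_neq[OF assms, of s t w v] tube_neq[OF assms, of s t v w] eq pq by auto
  qed
  with eq have g: "gauss (z, w) = gauss (z, v)"
    using assms(1) by (simp add: tube_def pq)
  \<comment> \<open>Pairing with the frame vectors \<open>gauss (z, 1)\<close> and
    \<open>gauss (z, \<i>)\<close> reads off the coordinates.\<close>
  have "Re w = Re v" "Im w = Im v"
    using gauss_inner_gauss[of z w 1] gauss_inner_gauss[of z v 1]
      gauss_inner_gauss[of z w \<i>] gauss_inner_gauss[of z v \<i>] by (simp_all add: g)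
  then show "p = q"
    using \<open>z = z'\<close> by (simp add: pq complex_eq_iff)
qed

section \<open>Smoothness and differential of the tube\<close>

lemma bounded_linear_mult_fst: "bounded_linear (\<lambda>x::real \<times> real. c * fst x)"
  by (intro bounded_linear_const_mult bounded_linear_fst)

lemma gauss_smooth: "C_infinity (gauss \<circ> angles)"
proof -
  have slope: "C_infinity (\<lambda>x::real \<times> real. slope (cis (fst x)))"
    unfolding slope_cis by (intro C_infinity_intros bounded_linear_mult_fst)
  have trig: "C_infinity (\<lambda>x::real \<times> real. Re (cis (fst x)))" "C_infinity (\<lambda>x::real \<times> real. Im (cis (fst x)))"
    "C_infinity (\<lambda>x::real \<times> real. Re (cis (snd x)))" "C_infinity (\<lambda>x::real \<times> real. Im (cis (snd x)))"
    unfolding cis.simps by (intro C_infinity_intros bounded_linear_fst bounded_linear_snd)+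
  show ?thesis
    unfolding comp_def gauss_def normal_def binormal_def angles_def fst_conv snd_conv
    by (intro C_infinity_intros one_plus_slope_sq_pos slope trig)
qed

lemma tube_smooth: "C_infinity (tube \<epsilon> \<circ> angles)"
proof -
  have "C_infinity (\<lambda>x::real \<times> real. core (cis (fst x)))"
    unfolding core_def Re_cis_power_numeral Im_cis_power_numeral cis.simps divide_inverse
    by (intro C_infinity_intros bounded_linear_fst bounded_linear_mult_fst)
  then have "C_infinity (\<lambda>x. core (cis (fst x)) + \<epsilon> *\<^sub>R (gauss \<circ> angles) x)"
    by (intro C_infinity_add C_infinity_scaleR C_infinity_const gauss_smooth)
  then show ?thesis
    by (simp add: tube_def comp_def angles_def)
qed

lemma C_infinity_has_derivative:
  assumes "C_infinity F"
  shows "(F has_derivative frechet_derivative F (at x)) (at x)"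
proof (rule C_k_differentiable)
  show "C_k (Suc 0) F"
    using assms unfolding C_infinity_def ..
qed

abbreviation gauss_deriv :: "real \<times> real \<Rightarrow> real \<times> real \<Rightarrow> real ^ 3" where
  "gauss_deriv x \<equiv> frechet_derivative (gauss \<circ> angles) (at x)"

lemma gauss_has_derivative: "((\<lambda>x. gauss (angles x)) has_derivative gauss_deriv x) (at x)"
  using C_infinity_has_derivative[OF gauss_smooth, of x] unfolding comp_def .

lemma has_vector_derivative_comp_fst:
  assumes "(g has_vector_derivative g') (at (fst x))"
  shows "((\<lambda>x. g (fst x)) has_derivative (\<lambda>v. fst v *\<^sub>R g')) (at x)"
  using has_derivative_compose[OF has_derivative_fst[OF has_derivative_ident]
      assms[unfolded has_vector_derivative_def]] by simp

lemma torus_differential_tube: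
  "torus_differential (tube \<epsilon>) x v =
    (fst v * (1 - cos (3 * fst x) / 2)) *\<^sub>R tang (cis (fst x)) + \<epsilon> *\<^sub>R gauss_deriv x v"
proof -
  have eq: "tube \<epsilon> \<circ> angles = (\<lambda>x. core (cis (fst x)) + \<epsilon> *\<^sub>R gauss (angles x))"
    by (simp add: tube_def angles_def fun_eq_iff)
  have "(tube \<epsilon> \<circ> angles has_derivative
      (\<lambda>v. fst v *\<^sub>R ((1 - cos (3 * fst x) / 2) *\<^sub>R tang (cis (fst x))) + \<epsilon> *\<^sub>R gauss_deriv x v)) (at x)"
    unfolding eq
    by (intro has_derivative_add has_vector_derivative_comp_fst core_cis_has_vector_derivative
        has_derivative_scaleR_right gauss_has_derivative)
  from fun_cong[OF frechet_derivative_at[OF this], of v] show ?thesis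
    by (simp add: torus_differential_def)
qed

text \<open>Differentiate the constant squared length of \<open>gauss\<close>.\<close>

lemma gauss_inner_gauss_deriv: "gauss (angles x) \<bullet> gauss_deriv x v = 0"
proof -
  have "((\<lambda>x. gauss (angles x) \<bullet> gauss (angles x)) has_derivative
      (\<lambda>v. gauss (angles x) \<bullet> gauss_deriv x v + gauss_deriv x v \<bullet> gauss (angles x))) (at x)"
    by (intro has_derivative_inner gauss_has_derivative)
  moreover have "(\<lambda>x. gauss (angles x) \<bullet> gauss (angles x)) = (\<lambda>x. 1)"
    by (simp add: angles_def gauss_inner_gauss flip: power2_eq_square)
  ultimately have "(\<lambda>v. gauss (angles x) \<bullet> gauss_deriv x v + gauss_deriv x v \<bullet> gauss (angles x)) = (\<lambda>v. 0)"
    using has_derivative_unique[OF _ has_derivative_const] by simp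
  from fun_cong[OF this, of v] show ?thesis
    by (simp add: inner_commute)
qed

text \<open>Differentiating the orthogonality of \<open>gauss\<close> and \<open>tang\<close> moves
  the derivative onto \<open>tang\<close>, where it is explicit and bounded by 1 + 1 + 12. The
  normalising factor of \<open>binormal\<close> need not be differentiated.\<close>

lemma gauss_deriv_inner_tang:
  "\<bar>gauss_deriv x v \<bullet> tang (cis (fst x))\<bar> \<le> 14 * \<bar>fst v\<bar>"
proof -
  define T' :: "real ^ 3" where "T' = vector [- sin (fst x), cos (fst x), - 12 * sin (3 * fst x)]"
  have "((\<lambda>x. gauss (angles x) \<bullet> tang (cis (fst x))) has_derivative
      (\<lambda>v. gauss (angles x) \<bullet> (fst v *\<^sub>R T') + gauss_deriv x v \<bullet> tang (cis (fst x)))) (at x)"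
    unfolding T'_def
    by (intro has_derivative_inner gauss_has_derivative has_vector_derivative_comp_fst
        tang_cis_has_vector_derivative)
  moreover have "(\<lambda>x. gauss (angles x) \<bullet> tang (cis (fst x))) = (\<lambda>x. 0)"
    by (simp add: angles_def gauss_inner_tang)
  ultimately have "(\<lambda>v. gauss (angles x) \<bullet> (fst v *\<^sub>R T') + gauss_deriv x v \<bullet> tang (cis (fst x))) = (\<lambda>v. 0)"
    using has_derivative_unique[OF _ has_derivative_const] by simp
  from fun_cong[OF this, of v]
  have "gauss_deriv x v \<bullet> tang (cis (fst x)) = - (fst v * (gauss (angles x) \<bullet> T'))"
    by simp
  then have "\<bar>gauss_deriv x v \<bullet> tang (cis (fst x))\<bar> = \<bar>fst v\<bar> * \<bar>gauss (angles x) \<bullet> T'\<bar>"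
    by (simp add: abs_mult)
  also have "\<dots> \<le> \<bar>fst v\<bar> * (1 * 14)"
  proof (rule mult_left_mono, rule order.trans[OF Cauchy_Schwarz_ineq2], rule mult_mono)
    show "norm (gauss (angles x)) \<le> 1"
      by (simp add: angles_def norm_gauss)
    show "norm T' \<le> 14"
      using norm_vector_3_le[of "- sin (fst x)" "cos (fst x)" "- 12 * sin (3 * fst x)"]
        abs_sin_le_one[of "fst x"] abs_cos_le_one[of "fst x"] abs_sin_le_one[of "3 * fst x"]
      unfolding T'_def by argo
  qed auto
  finally show ?thesis
    by simp
qed

lemma gauss_deriv_vertical: "gauss_deriv x (0, b) = b *\<^sub>R gauss (cis (fst x), \<i> * cis (snd x))"
proof -
  have "((\<lambda>y. gauss (angles (fst x, y))) has_derivative (\<lambda>b. gauss_deriv x (0, b))) (at (snd x))"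
    using has_derivative_compose[OF has_derivative_Pair[OF has_derivative_const has_derivative_ident],
        of "\<lambda>x. gauss (angles x)" _ "fst x" "snd x"] gauss_has_derivative[of x]
    by simp
  moreover have "((\<lambda>y. gauss (angles (fst x, y))) has_derivative
      (\<lambda>b. b *\<^sub>R gauss (cis (fst x), \<i> * cis (snd x)))) (at (snd x))"
    unfolding angles_def gauss_def fst_conv snd_conv cis.simps
    by (auto intro!: derivative_eq_intros simp: algebra_simps)
  ultimately show ?thesis
    by (metis has_derivative_unique)
qed

text \<open>Paired with the tangent, the core contributes at least
  \<open>\<bar>fst v\<bar> / 2\<close> in absolute value, the normal field at most
  \<open>14 / 100 * \<bar>fst v\<bar>\<close>. So a kernel vector points along the normal circle,
  where \<open>gauss\<close> moves with unit speed.\<close>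

lemma inj_torus_differential_tube:
  assumes "0 < \<epsilon>" "\<epsilon> \<le> 1 / 100"
  shows "inj (torus_differential (tube \<epsilon>) x)"
proof -
  have "linear (torus_differential (tube \<epsilon>) x)"
    unfolding torus_differential_def
    by (rule has_derivative_linear[OF C_infinity_has_derivative[OF tube_smooth]])
  moreover have "v = 0" if v: "torus_differential (tube \<epsilon>) x v = 0" for v
  proof -
    define T where "T = tang (cis (fst x))"
    have "T \<bullet> T \<ge> 1"
      by (simp add: T_def tang_def inner_vector_3 flip: power2_eq_square)
    have "(fst v * (1 - cos (3 * fst x) / 2)) *\<^sub>R T + \<epsilon> *\<^sub>R gauss_deriv x v = 0"
      using v by (simp add: torus_differential_tube T_def)
    then have "((fst v * (1 - cos (3 * fst x) / 2)) *\<^sub>R T + \<epsilon> *\<^sub>R gauss_deriv x v) \<bullet> T = 0"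
      by simp
    then have "fst v * (1 - cos (3 * fst x) / 2) * (T \<bullet> T) = - (\<epsilon> * (gauss_deriv x v \<bullet> T))"
      by (simp add: inner_add_left)
    then have "\<bar>fst v\<bar> * (\<bar>1 - cos (3 * fst x) / 2\<bar> * \<bar>T \<bullet> T\<bar>) = \<epsilon> * \<bar>gauss_deriv x v \<bullet> T\<bar>"
      using assms(1) by (metis abs_minus_cancel abs_mult abs_of_pos mult.assoc)
    moreover have "1 / 2 * 1 \<le> \<bar>1 - cos (3 * fst x) / 2\<bar> * \<bar>T \<bullet> T\<bar>"
      using \<open>T \<bullet> T \<ge> 1\<close> cos_le_one[of "3 * fst x"] by (intro mult_mono) linarith+
    moreover have "\<epsilon> * \<bar>gauss_deriv x v \<bullet> T\<bar> \<le> 1 / 100 * (14 * \<bar>fst v\<bar>)"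
      using assms gauss_deriv_inner_tang[of x v] by (intro mult_mono) (auto simp: T_def)
    ultimately have "\<bar>fst v\<bar> * (1 / 2 * 1) \<le> 1 / 100 * (14 * \<bar>fst v\<bar>)"
      using mult_left_mono[OF _ abs_ge_zero[of "fst v"]] by fastforce
    then have [simp]: "fst v = 0"
      by simp
    then have "v = (0, snd v)"
      by (simp add: prod_eq_iff)
    moreover have "gauss_deriv x v = 0"
      using v assms(1) by (simp add: torus_differential_tube)
    ultimately have "snd v *\<^sub>R gauss (cis (fst x), \<i> * cis (snd x)) = 0"
      using gauss_deriv_vertical by metis
    moreover have "norm (gauss (cis (fst x), \<i> * cis (snd x))) = 1"
      by (intro norm_gauss) (simp_all add: norm_mult)
    ultimately show ?thesis
      by (auto simp: prod_eq_iff)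
  qed
  ultimately show ?thesis
    by (simp add: linear_injective_0)
qed

section \<open>Continuity, embedding and Gauss map of the tube\<close>

lemma continuous_on_vector_3:
  fixes f g h :: "'a::topological_space \<Rightarrow> real"
  assumes "continuous_on S f" "continuous_on S g" "continuous_on S h"
  shows "continuous_on S (\<lambda>x. vector [f x, g x, h x] :: real ^ 3)"
  unfolding vector_3_decompose[of "f _"]
  by (intro continuous_on_add continuous_on_scaleR continuous_on_const assms)

lemma continuous_on_frame:
  assumes "continuous_on S f"
  shows "continuous_on S (\<lambda>x. normal (f x))" "continuous_on S (\<lambda>x. binormal (f x))"
proof -
  have slope: "continuous_on S (\<lambda>x. slope (f x))"
    unfolding slope_def
    by (intro continuous_on_add continuous_on_mult continuous_on_power continuous_on_const
        continuous_on_Re assms)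
  have "1 + (slope z)\<^sup>2 \<noteq> 0" for z
    using one_plus_slope_sq_pos[of z] by linarith
  then show "continuous_on S (\<lambda>x. binormal (f x))"
    unfolding binormal_def
    by (intro continuous_on_scaleR continuous_on_powr continuous_on_vector_3 continuous_on_add
        continuous_on_power continuous_on_mult continuous_on_const slope
        continuous_on_Re continuous_on_Im assms) blast
  show "continuous_on S (\<lambda>x. normal (f x))"
    unfolding normal_def
    by (intro continuous_on_vector_3 continuous_on_minus continuous_on_const
        continuous_on_Re continuous_on_Im assms)
qed

lemma continuous_on_tube: "continuous_on S (tube \<epsilon>)"
proof -
  have "continuous_on S (\<lambda>p. core (fst p))"
    unfolding core_def divide_inverse
    by (intro continuous_on_vector_3 continuous_on_add continuous_on_diff continuous_on_mult
        continuous_on_minus continuous_on_const continuous_on_Re continuous_on_Im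
        continuous_on_power continuous_on_fst continuous_on_id)
  then show ?thesis
    unfolding tube_def gauss_def
    by (intro continuous_on_add continuous_on_scaleR continuous_on_frame continuous_on_const
        continuous_on_Re continuous_on_Im continuous_on_fst continuous_on_snd continuous_on_id)
qed

lemma smooth_torus_embedding_tube:
  assumes "0 < \<epsilon>" "\<epsilon> \<le> 1 / 100" "2 * \<epsilon> < sin (1 / 20)"
  shows "smooth_torus_embedding (tube \<epsilon>)"
proof -
  have "compact torus"
    by (simp add: torus_def compact_Times)
  \<comment> \<open>A continuous injection of a compact space into a Hausdorff space is an
    embedding.\<close>
  then have "embedding_map (top_of_set torus) euclidean (tube \<epsilon>)"
    using tube_inj_on[OF assms] continuous_on_tube
    by (intro continuous_imp_embedding_map) (auto simp: compact_space_subtopology)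
  then show ?thesis
    using assms by (simp add: smooth_torus_embedding_def torus_smooth_def tube_smooth inj_torus_differential_tube)
qed

lemma gauss_map_tube: "gauss_map (tube \<epsilon>) gauss"
proof -
  have "gauss (angles x) \<bullet> torus_differential (tube \<epsilon>) x v = 0" for x v
    unfolding torus_differential_tube inner_add_right inner_scaleR_right gauss_inner_gauss_deriv
    by (simp add: angles_def gauss_inner_tang)
  then show ?thesis
    by (auto simp: gauss_map_def torus_smooth_def gauss_smooth torus_def norm_gauss)
qed

subsection \<open>Shadows of the tube\<close>

text \<open>This is skewness of the core: a vector orthogonal to both frame vectors is a multiple of
  the tangent.\<close>

lemma frame_annihilator_unique:
  assumes "norm z = 1" "norm z' = 1" "u \<noteq> 0"
    "normal z \<bullet> u = 0" "binormal z \<bullet> u = 0" "normal z' \<bullet> u = 0" "binormal z' \<bullet> u = 0"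
  shows "z = z'"
proof -
  define k where "k = (\<lambda>z. Re z * u $ 1 + Im z * u $ 2)"
  have u: "u $ 1 = k z * Re z \<and> u $ 2 = k z * Im z \<and> u $ 3 = k z * slope z"
    if "norm z = 1" "normal z \<bullet> u = 0" "binormal z \<bullet> u = 0" for z
  proof -
    have sq: "(Re z)\<^sup>2 + (Im z)\<^sup>2 = 1"
      using that(1) by (simp add: cmod_def)
    have 1: "Im z * u $ 1 = Re z * u $ 2"
      using that(2) by (simp add: normal_def inner_vec_def sum_3)
    have "u $ 1 = ((Re z)\<^sup>2 + (Im z)\<^sup>2) * u $ 1" "u $ 2 = ((Re z)\<^sup>2 + (Im z)\<^sup>2) * u $ 2"
      by (simp_all add: sq)
    then have "u $ 1 = k z * Re z" "u $ 2 = k z * Im z"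
      using 1 unfolding k_def by algebra+
    moreover have "vector [slope z * Re z, slope z * Im z, - 1] \<bullet> u = 0"
      using that(3) one_plus_slope_sq_pos[of z] by (auto simp: binormal_def)
    then have "u $ 3 = k z * slope z"
      by (simp add: inner_vec_def sum_3 k_def algebra_simps)
    ultimately show ?thesis by simp
  qed
  note uz = u[OF assms(1,4,5)] and uz' = u[OF assms(2,6,7)]
  have k: "u $ 1 ^ 2 + u $ 2 ^ 2 = (k z)\<^sup>2" if "norm z = 1" "u $ 1 = k z * Re z" "u $ 2 = k z * Im z" for z
    using that by (simp add: cmod_def power_mult_distrib flip: distrib_left)
  have "(k z)\<^sup>2 = (k z')\<^sup>2"
    using k[of z] k[of z'] uz uz' assms(1,2) by simp
  moreover have nz: "k z \<noteq> 0"
    using assms(3) uz by (auto simp: vec_eq_iff forall_3)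
  ultimately consider "k z' = k z" | "k z' = - k z"
    by (auto simp: power2_eq_iff)
  then show ?thesis
  proof cases
    case 1
    then show ?thesis
      using uz uz' nz by (simp add: complex_eq_iff)
  next
    case 2
    then have "k z * Re z = k z * - Re z'" "k z * Im z = k z * - Im z'" "k z * slope z = k z * - slope z'"
      using uz uz' by auto
    then have "Re z = - Re z'" "Im z = - Im z'" "slope z = - slope z'"
      using nz by (simp_all only: mult_cancel_left) simp_all
    moreover from this have "z = - z'"
      by (simp add: complex_eq_iff)
    \<comment> \<open>The cube is odd, so the slopes at \<open>z\<close> and \<open>- z\<close> add
      up to 2 and cannot be opposite.\<close>
    ultimately show ?thesis
      by (simp add: slope_def)
  qed
qed

lemma connected_circle_minus:
  assumes "\<And>z z'. z \<in> A \<Longrightarrow> z' \<in> A \<Longrightarrow> z = z'" "A \<subseteq> sphere 0 1"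
  shows "connected (sphere (0::complex) 1 - A)"
proof (cases "A = {}")
  case True
  then show ?thesis
    by (simp add: connected_sphere)
next
  case False
  then obtain a where A: "A = {a}"
    using assms(1) by blast
  \<comment> \<open>Stereographic projection from \<open>a\<close> onto a line.\<close>
  then have "(sphere 0 1 - A) homeomorphic {x. (1::complex) \<bullet> x = 0}"
    using assms(2) homeomorphic_punctured_sphere_hyperplane[of 1 a 0 1 0] by simp
  then show ?thesis
    using homeomorphic_connectedness convex_connected[OF convex_hyperplane] by blast
qed

lemma connected_shadow_gauss:
  assumes "u \<noteq> 0"
  shows "connected (shadow gauss u)"
proof -
  \<comment> \<open>The projection of \<open>u\<close> to the normal plane at \<open>z\<close>, as a
    complex number. The shadow over \<open>z\<close> is the open half circle centred at the
    direction of \<open>c z\<close>, and \<open>A\<close> collects the points where it is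
    empty.\<close>
  define c where "c = (\<lambda>z. of_real (normal z \<bullet> u) + \<i> * of_real (binormal z \<bullet> u))"
  define A where "A = {z \<in> sphere 0 1. c z = 0}"
  \<comment> \<open>Rotates the right half plane towards \<open>c z\<close> and retracts it to the
    unit circle, so that the shadow becomes the image of a product of connected sets.\<close>
  define \<Phi> where "\<Phi> = (\<lambda>(z, v). (z, sgn (v * c z)))"
  have gauss: "gauss (z, w) \<bullet> u = Re (w * cnj (c z))" for z w
    by (simp add: gauss_def c_def inner_add_left)
  have Re: "Re (sgn (v * c z) * cnj (c z)) = Re v * norm (c z) / norm v" for v z
  proof -
    have "sgn (v * c z) * cnj (c z) = sgn v * of_real (norm (c z))"
      by (cases "c z = 0")
        (simp_all add: sgn_eq norm_mult field_simps power2_eq_square flip: complex_norm_square)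
    then show ?thesis
      by (simp add: sgn_eq)
  qed
  have "shadow gauss u = \<Phi> ` ((sphere 0 1 - A) \<times> {v. Re v > 0})" (is "?L = ?R")
  proof (intro equalityI subsetI)
    fix p assume "p \<in> ?L"
    then obtain z w where p: "p = (z, w)" "norm z = 1" "norm w = 1" "Re (w * cnj (c z)) > 0"
      using gauss by (auto simp: shadow_def torus_def)
    then have "c z \<noteq> 0"
      by auto
    moreover have "w * cnj (c z) * c z = w * of_real ((norm (c z))\<^sup>2)"
      by (simp only: complex_norm_square mult_ac)
    moreover have "sgn (w * of_real ((norm (c z))\<^sup>2)) = w" if "c z \<noteq> 0"
      using p(3) that unfolding sgn_mult sgn_of_real by (simp add: sgn_eq)
    ultimately have "sgn (w * cnj (c z) * c z) = w"
      by (simp only: simp_thms)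
    \<comment> \<open>Multiplying by \<open>cnj (c z)\<close> undoes the rotation up to a positive
      factor, which \<open>sgn\<close> removes.\<close>
    then have "p = \<Phi> (z, w * cnj (c z))"
      by (simp add: \<Phi>_def p(1))
    then show "p \<in> ?R"
      using p \<open>c z \<noteq> 0\<close> by (intro image_eqI) (auto simp: A_def)
  next
    fix p assume "p \<in> ?R"
    then obtain z v where "p = \<Phi> (z, v)" "z \<in> sphere 0 1 - A" "Re v > 0"
      by blast
    then have p: "p = (z, sgn (v * c z))" "norm z = 1" "c z \<noteq> 0" "Re v > 0"
      by (simp_all add: \<Phi>_def A_def)
    then have "v \<noteq> 0"
      by auto
    with p have "gauss p \<bullet> u > 0"
      unfolding p(1) gauss Re by simp
    then show "p \<in> ?L"
      using p \<open>v \<noteq> 0\<close> by (simp add: shadow_def torus_def norm_sgn)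
  qed
  moreover have "connected ((sphere 0 1 - A) \<times> {v. Re v > 0})"
  proof (intro connected_Times connected_circle_minus)
    show "connected {v. Re v > 0}"
      by (intro convex_connected convex_halfspace_Re_gt)
    show "z = z'" if "z \<in> A" "z' \<in> A" for z z'
      using that frame_annihilator_unique[of z z' u] assms by (auto simp: A_def c_def complex_eq_iff)
  qed (auto simp: A_def)
  moreover have "continuous_on ((sphere 0 1 - A) \<times> {v. Re v > 0}) \<Phi>"
  proof -
    have "continuous_on S (\<lambda>p. c (fst p))" for S :: "(complex \<times> complex) set"
      unfolding c_def
      by (intro continuous_on_add continuous_on_mult continuous_on_const continuous_on_of_real
          continuous_on_inner continuous_on_frame continuous_on_fst continuous_on_id)
    \<comment> \<open>Continuity of \<open>sgn\<close> needs a nonzero argument; removing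
      \<open>A\<close> and taking \<open>Re v > 0\<close> ensures this.\<close>
    then show ?thesis
      unfolding \<Phi>_def case_prod_beta
      by (intro continuous_on_Pair continuous_on_sgn continuous_on_mult continuous_on_fst
          continuous_on_snd continuous_on_id) (auto simp: A_def)
  qed
  ultimately show ?thesis
    by (metis connected_continuous_image)
qed

theorem theorem1p2:
  shows "\<exists>f n. smooth_torus_embedding f \<and> gauss_map f n \<and>
           (\<forall>u\<in>sphere 0 1. connected (shadow n u))"
proof -
  \<comment> \<open>The first bound serves close parameters and the immersion, the second far apart
    ones; the 4 makes \<open>2 * \<epsilon>\<close> strictly less than
    \<open>sin (1 / 20)\<close>.\<close>
  define \<epsilon> :: real where "\<epsilon> = min (1 / 100) (sin (1 / 20) / 4)"
  have "sin (1 / 20) > (0::real)"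
    using pi_ge_two by (intro sin_gt_zero) auto
  then have "smooth_torus_embedding (tube \<epsilon>)"
    by (intro smooth_torus_embedding_tube) (auto simp: \<epsilon>_def min_def)
  moreover have "connected (shadow gauss u)" if "u \<in> sphere 0 1" for u
    using that by (intro connected_shadow_gauss) auto
  ultimately show ?thesis
    using gauss_map_tube by blast
qed

end
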